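(* Roman Vertex Cover, parameterized by the upper bound $k$ on the weight of the solution, is fixed-parameter tractable: it can be decided in time $f(k)\cdot\mathrm{poly}(|V|+|E|)$ for some computable function $f$.
   Context: For a graph $G=(V,E)$, a Roman vertex cover is a pair $(R_1,R_2)$ with $R_1\subseteq E$ and $R_2\subseteq V$ such that every edge $e\in E$ satisfies $e\in R_1$ or $e\cap R_2\ne\emptyset$; its weight is $\omega(R_1,R_2)=|R_1|+2|R_2|$. Roman Vertex Cover: given a graph $G$ and $k\in\mathbb N$, decide whether $G$ has a Roman vertex cover of weight at most $k$. *)

theory Defs
  imports "HOL-Computational_Algebra.Polynomial"
begin

section \<open>Random access machines\<close>

text \<open>
  A configuration consists of a program counter, the contents of the registers (of which a program
  can only name finitely many) and the contents of the random access memory. All cells hold natural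
  numbers. Every instruction costs one time unit; since the only arithmetic operations are addition
  and truncated subtraction, the length of the largest number grows by at most one bit per step
  (up to the constants of the program), so
  running times are polynomially related to those of Turing machines.
\<close>

type_synonym config = "nat \<times> (nat \<Rightarrow> nat) \<times> (nat \<Rightarrow> nat)"

datatype instr =
    Const nat nat
  | Add nat nat nat
  | Sub nat nat nat
  | Load nat nat
  | Store nat nat
  | Jump nat
  | Jump_Zero nat nat

fun exec_instr :: "instr \<Rightarrow> config \<Rightarrow> config" where
  "exec_instr (Const i c) (pc, r, m) = (Suc pc, r(i := c), m)"
| "exec_instr (Add i j l) (pc, r, m) = (Suc pc, r(i := r j + r l), m)"
| "exec_instr (Sub i j l) (pc, r, m) = (Suc pc, r(i := r j - r l), m)"
| "exec_instr (Load i j) (pc, r, m) = (Suc pc, r(i := m (r j)), m)"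
| "exec_instr (Store i j) (pc, r, m) = (Suc pc, r, m(r i := r j))"
| "exec_instr (Jump l) (pc, r, m) = (l, r, m)"
| "exec_instr (Jump_Zero i l) (pc, r, m) = (if r i = 0 then l else Suc pc, r, m)"

text \<open>The machine halts as soon as the program counter leaves the program.\<close>

definition halted :: "instr list \<Rightarrow> config \<Rightarrow> bool" where
  "halted P c \<longleftrightarrow> length P \<le> fst c"

definition step :: "instr list \<Rightarrow> config \<Rightarrow> config" where
  "step P c = (if halted P c then c else exec_instr (P ! fst c) c)"

text \<open>The input is a list of numbers, written to the memory cells from address 0 on; its length is
  given in register 0. Register 0 also holds the output.\<close>

definition init_config :: "nat list \<Rightarrow> config" where
  "init_config xs =
     (0, (\<lambda>_. 0)(0 := length xs), (\<lambda>a. if a < length xs then xs ! a else 0))"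

text \<open>Halted configurations are fixed points of \<^const>\<open>step\<close>, so \<open>t\<close> is an upper bound on the
  number of executed instructions.\<close>

definition computes_within :: "instr list \<Rightarrow> nat list \<Rightarrow> nat \<Rightarrow> nat \<Rightarrow> bool" where
  "computes_within P xs t y \<longleftrightarrow>
     (let c = (step P ^^ t) (init_config xs) in halted P c \<and> fst (snd c) 0 = y)"

definition computable :: "(nat \<Rightarrow> nat) \<Rightarrow> bool" where
  "computable f \<longleftrightarrow> (\<exists>P. \<forall>k. \<exists>t. computes_within P [k] t (f k))"


section \<open>Fixed-parameter tractability\<close>

text \<open>
  A parameterized decision problem is given by the set \<open>I\<close> of its instances, the set \<open>Y\<close> of its
  yes-instances, a parameter \<open>\<kappa>\<close> and a size measure \<open>sz\<close>. The relation \<open>enc\<close> tells which inputs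
  represent an instance; the machine has to answer correctly on every representation.
\<close>

definition fixed_parameter_tractable ::
  "'i set \<Rightarrow> ('i \<Rightarrow> nat list \<Rightarrow> bool) \<Rightarrow> 'i set \<Rightarrow> ('i \<Rightarrow> nat) \<Rightarrow> ('i \<Rightarrow> nat) \<Rightarrow> bool" where
  "fixed_parameter_tractable I enc Y \<kappa> sz \<longleftrightarrow>
     (\<exists>(P :: instr list) (f :: nat \<Rightarrow> nat) (p :: nat poly). computable f \<and>
        (\<forall>i\<in>I. \<forall>xs. enc i xs \<longrightarrow>
           computes_within P xs (f (\<kappa> i) * poly p (sz i)) (if i \<in> Y then 1 else 0)))"


section \<open>Roman Vertex Cover\<close>

definition graph :: "'a set \<Rightarrow> 'a set set \<Rightarrow> bool" where
  "graph V E \<longleftrightarrow> finite V \<and> (\<forall>e\<in>E. e \<subseteq> V \<and> card e = 2)"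

definition roman_vertex_cover ::
  "'a set \<Rightarrow> 'a set set \<Rightarrow> 'a set set \<Rightarrow> 'a set \<Rightarrow> bool" where
  "roman_vertex_cover V E R1 R2 \<longleftrightarrow>
     R1 \<subseteq> E \<and> R2 \<subseteq> V \<and> (\<forall>e\<in>E. e \<in> R1 \<or> e \<inter> R2 \<noteq> {})"

definition rvc_weight :: "'a set set \<Rightarrow> 'a set \<Rightarrow> nat" where
  "rvc_weight R1 R2 = card R1 + 2 * card R2"

text \<open>
  Vertices are natural numbers, without any relation between their values and the size of the graph.
  For the encoding, vertices and edges are enumerated in an arbitrary order and each edge is given
  by the positions of its two ends, in either order.
\<close>

type_synonym rvc_instance = "nat set \<times> nat set set \<times> nat"

definition rvc_instances :: "rvc_instance set" where
  "rvc_instances = {(V, E, k). graph V E}"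

definition rvc_yes :: "rvc_instance set" where
  "rvc_yes = {(V, E, k). graph V E \<and>
     (\<exists>R1 R2. roman_vertex_cover V E R1 R2 \<and> rvc_weight R1 R2 \<le> k)}"

definition rvc_encoding :: "rvc_instance \<Rightarrow> nat list \<Rightarrow> bool" where
  "rvc_encoding = (\<lambda>(V, E, k) xs. \<exists>vs es.
     distinct vs \<and> set vs = V \<and>
     (\<forall>(i, j)\<in>set es. i < length vs \<and> j < length vs) \<and>
     distinct (map (\<lambda>(i, j). {vs ! i, vs ! j}) es) \<and>
     set (map (\<lambda>(i, j). {vs ! i, vs ! j}) es) = E \<and>
     xs = k # length vs # length es # concat (map (\<lambda>(i, j). [i, j]) es))"

definition rvc_parameter :: "rvc_instance \<Rightarrow> nat" where
  "rvc_parameter = (\<lambda>(V, E, k). k)"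

definition rvc_size :: "rvc_instance \<Rightarrow> nat" where
  "rvc_size = (\<lambda>(V, E, k). card V + card E)"

lemma rvc_encoding_exists:
  assumes "i \<in> rvc_instances"
  shows "\<exists>xs. rvc_encoding i xs"
proof -
  obtain V E k where i: "i = (V, E, k)" by (cases i)
  have fV: "finite V" and E: "\<And>e. e \<in> E \<Longrightarrow> e \<subseteq> V \<and> card e = 2"
    using assms by (auto simp: i rvc_instances_def graph_def)
  have "E \<subseteq> Pow V" using E by blast
  then have "finite E" using fV by (meson finite_Pow_iff finite_subset)
  then obtain ls where ls: "distinct ls" "set ls = E"
    using finite_distinct_list by blast
  obtain vs where vs: "distinct vs" "set vs = V"
    using fV finite_distinct_list by blast
  have "\<exists>q. fst q < length vs \<and> snd q < length vs \<and> {vs ! fst q, vs ! snd q} = e"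
    if e: "e \<in> E" for e
  proof -
    obtain u v where uv: "e = {u, v}"
      using E[OF e] by (auto simp: card_2_iff)
    then have "u \<in> set vs" "v \<in> set vs" using E[OF e] vs by auto
    then obtain a b where "a < length vs" "b < length vs" "vs ! a = u" "vs ! b = v"
      by (auto simp: in_set_conv_nth)
    then show ?thesis using uv by (intro exI[of _ "(a, b)"]) simp
  qed
  then obtain q where q: "\<And>e. e \<in> E \<Longrightarrow> fst (q e) < length vs \<and> snd (q e) < length vs \<and>
      {vs ! fst (q e), vs ! snd (q e)} = e"
    by metis
  have m: "map (\<lambda>(i, j). {vs ! i, vs ! j}) (map q ls) = ls"
    using q ls by (auto simp: case_prod_unfold intro!: map_idI)
  have b: "\<forall>(i, j)\<in>set (map q ls). i < length vs \<and> j < length vs"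
    using q ls by (auto simp: case_prod_unfold)
  show ?thesis
    unfolding i rvc_encoding_def prod.case
    using vs ls m b by metis
qed

end

theory Submission
  imports Defs
begin

text \<open>
  Bounded search tree: an edge not yet covered must be put into \<open>R\<^sub>1\<close> at cost 1, or one of its ends
  must be put into \<open>R\<^sub>2\<close> at cost 2, so at most \<open>k\<close> ternary decisions are made. Instead of
  backtracking, the machine runs through all numbers \<open>s < 3 ^ k\<close> and, in one pass over the edges,
  carries out the decisions given by the base-3 digits of \<open>s\<close>, comparing the resulting weight with
  \<open>k\<close>. Digits are extracted by repeated subtraction, which costs another factor \<open>3 ^ k\<close>; the total
  time is \<open>9 ^ k\<close> times a linear function of the number of edges.
\<close>

section \<open>Structured commands for the random access machine\<close>

definition reaches :: "instr list \<Rightarrow> nat \<Rightarrow> config \<Rightarrow> config \<Rightarrow> bool" where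
  "reaches P t c c' \<longleftrightarrow> (\<exists>t'\<le>t. (step P ^^ t') c = c')"

lemma reaches_refl: "reaches P t c c"
  unfolding reaches_def by (intro exI[of _ 0]) simp

lemma reaches_trans:
  assumes "reaches P t c c'" and "reaches P u c' c''"
  shows "reaches P (t + u) c c''"
proof -
  obtain t' u' where "t' \<le> t" "u' \<le> u" "(step P ^^ t') c = c'" "(step P ^^ u') c' = c''"
    using assms unfolding reaches_def by blast
  then have "t' + u' \<le> t + u" "(step P ^^ (t' + u')) c = c''"
    by (auto simp: add.commute[of t'] funpow_add)
  then show ?thesis unfolding reaches_def by blast
qed

lemma reaches_mono: "reaches P t c c' \<Longrightarrow> t \<le> u \<Longrightarrow> reaches P u c c'"
  unfolding reaches_def by (blast intro: le_trans)

lemma reaches_step: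
  assumes "pc < length P" and "exec_instr (P ! pc) (pc, r, m) = c'"
  shows "reaches P 1 (pc, r, m) c'"
  unfolding reaches_def using assms by (intro exI[of _ 1]) (simp add: step_def halted_def)

lemma reaches_Jump:
  assumes "pc < length P" and "P ! pc = Jump l"
  shows "reaches P 1 (pc, r, m) (l, r, m)"
  using assms by (intro reaches_step) simp_all

lemma reaches_Jump_Zero:
  assumes "pc < length P" and "P ! pc = Jump_Zero x l"
  shows "reaches P 1 (pc, r, m) (if r x = 0 then l else pc + 1, r, m)"
  using assms by (intro reaches_step) simp_all

lemma funpow_step_halted: "halted P c \<Longrightarrow> (step P ^^ t) c = c"
  by (induction t) (auto simp: step_def)

lemma computes_withinI:
  assumes "reaches P t (init_config xs) c" and "halted P c" and "fst (snd c) 0 = y"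
  shows "computes_within P xs t y"
proof -
  obtain t' where "t' \<le> t" and final: "(step P ^^ t') (init_config xs) = c"
    using assms(1) unfolding reaches_def by blast
  then have "(step P ^^ t) (init_config xs) = (step P ^^ (t - t')) c"
    by (simp flip: final funpow_add comp_apply[of "step P ^^ (t - t')"])
  then show ?thesis
    using assms(2,3) funpow_step_halted by (simp add: computes_within_def)
qed

type_synonym cells = "nat \<Rightarrow> nat"

datatype com =
    Block "instr list"
  | Seq com com  (infixr \<open>;;\<close> 60)
  | If_Nonzero nat com com
  | While_Nonzero nat com

fun code_size :: "com \<Rightarrow> nat" where
  "code_size (Block is) = length is"
| "code_size (c ;; d) = code_size c + code_size d"
| "code_size (If_Nonzero x c d) = code_size c + code_size d + 2"
| "code_size (While_Nonzero x c) = code_size c + 2"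

fun compile :: "nat \<Rightarrow> com \<Rightarrow> instr list" where
  "compile pc (Block is) = is"
| "compile pc (c ;; d) = compile pc c @ compile (pc + code_size c) d"
| "compile pc (If_Nonzero x c d) =
     Jump_Zero x (pc + code_size c + 2) # compile (pc + 1) c @
     Jump (pc + code_size c + code_size d + 2) # compile (pc + code_size c + 2) d"
| "compile pc (While_Nonzero x c) =
     Jump_Zero x (pc + code_size c + 2) # compile (pc + 1) c @ [Jump pc]"

lemma length_compile: "length (compile pc c) = code_size c"
  by (induction c arbitrary: pc) auto

definition code_at :: "instr list \<Rightarrow> nat \<Rightarrow> instr list \<Rightarrow> bool" where
  "code_at P pc is \<longleftrightarrow> (\<forall>i<length is. pc + i < length P \<and> P ! (pc + i) = is ! i)"

lemma code_at_Nil: "code_at P pc []"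
  by (simp add: code_at_def)

lemma code_at_Cons:
  "code_at P pc (i # is) \<longleftrightarrow> pc < length P \<and> P ! pc = i \<and> code_at P (pc + 1) is"
  by (auto simp: code_at_def All_less_Suc2)

lemma code_at_append:
  "code_at P pc (is @ js) \<longleftrightarrow> code_at P pc is \<and> code_at P (pc + length is) js"
  by (induction "is" arbitrary: pc) (simp_all add: code_at_Nil code_at_Cons)

definition wp :: "com \<Rightarrow> nat \<Rightarrow> (cells \<Rightarrow> cells \<Rightarrow> bool) \<Rightarrow> cells \<Rightarrow> cells \<Rightarrow> bool" where
  "wp c t Q r m \<longleftrightarrow> (\<forall>P pc. code_at P pc (compile pc c) \<longrightarrow>
     (\<exists>r' m'. reaches P t (pc, r, m) (pc + code_size c, r', m') \<and> Q r' m'))"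

lemma wpI:
  assumes "\<And>P pc. code_at P pc (compile pc c) \<Longrightarrow>
    \<exists>r' m'. reaches P t (pc, r, m) (pc + code_size c, r', m') \<and> Q r' m'"
  shows "wp c t Q r m"
  using assms by (simp add: wp_def)

lemma wpE:
  assumes "wp c t Q r m" and "code_at P pc (compile pc c)"
  obtains r' m' where "reaches P t (pc, r, m) (pc + code_size c, r', m')" and "Q r' m'"
  using assms unfolding wp_def by blast

lemma wp_mono_time:
  assumes "wp c t Q r m" and "t \<le> u"
  shows "wp c u Q r m"
proof (rule wpI)
  fix P pc
  assume "code_at P pc (compile pc c)"
  with assms(1) obtain r' m' where "reaches P t (pc, r, m) (pc + code_size c, r', m')" "Q r' m'"
    by (rule wpE)
  then show "\<exists>r' m'. reaches P u (pc, r, m) (pc + code_size c, r', m') \<and> Q r' m'"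
    using assms(2) reaches_mono by blast
qed

lemma wp_mono_post:
  assumes "wp c t Q r m" and "\<And>r' m'. Q r' m' \<Longrightarrow> Q' r' m'"
  shows "wp c t Q' r m"
  using assms unfolding wp_def by blast

fun is_jump :: "instr \<Rightarrow> bool" where
  "is_jump (Jump l) = True"
| "is_jump (Jump_Zero i l) = True"
| "is_jump _ = False"

definition exec_basic :: "instr \<Rightarrow> cells \<times> cells \<Rightarrow> cells \<times> cells" where
  "exec_basic i s = snd (exec_instr i (0, s))"

lemma exec_basic_simps [simp]:
  "exec_basic (Const i a) (r, m) = (r(i := a), m)"
  "exec_basic (Add i j l) (r, m) = (r(i := r j + r l), m)"
  "exec_basic (Sub i j l) (r, m) = (r(i := r j - r l), m)"
  "exec_basic (Load i j) (r, m) = (r(i := m (r j)), m)"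
  "exec_basic (Store i j) (r, m) = (r, m(r i := r j))"
  by (simp_all add: exec_basic_def)

lemma exec_instr_basic: "\<not> is_jump i \<Longrightarrow> exec_instr i (pc, s) = (pc + 1, exec_basic i s)"
  by (cases i; cases s) (simp_all add: exec_basic_def)

lemma reaches_block:
  assumes "code_at P pc is" and "\<forall>i\<in>set is. \<not> is_jump i"
  shows "reaches P (length is) (pc, s) (pc + length is, fold exec_basic is s)"
  using assms
proof (induction "is" arbitrary: pc s)
  case Nil
  show ?case by (simp add: reaches_refl)
next
  case (Cons i "is")
  obtain r m where s_eq: "s = (r, m)" by (cases s)
  have "reaches P 1 (pc, s) (pc + 1, exec_basic i s)"
    using Cons.prems exec_instr_basic
    unfolding s_eq by (intro reaches_step) (simp_all add: code_at_Cons)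
  moreover have "reaches P (length is) (pc + 1, exec_basic i s)
      (pc + 1 + length is, fold exec_basic is (exec_basic i s))"
    using Cons.prems by (intro Cons.IH) (simp_all add: code_at_Cons)
  ultimately show ?case using reaches_trans by fastforce
qed

lemma wp_block:
  assumes "length is = t" and "\<forall>i\<in>set is. \<not> is_jump i"
    and "case_prod Q (fold exec_basic is (r, m))"
  shows "wp (Block is) t Q r m"
proof (rule wpI)
  fix P pc
  assume "code_at P pc (compile pc (Block is))"
  then have "reaches P (length is) (pc, r, m) (pc + length is, fold exec_basic is (r, m))"
    using reaches_block assms(2) by simp
  then show "\<exists>r' m'. reaches P t (pc, r, m) (pc + code_size (Block is), r', m') \<and> Q r' m'"
    using assms(1,3) by (cases "fold exec_basic is (r, m)") auto
qed

lemma wp_seq: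
  assumes "wp c t (wp d u Q) r m"
  shows "wp (c ;; d) (t + u) Q r m"
proof (rule wpI)
  fix P pc
  assume "code_at P pc (compile pc (c ;; d))"
  then have code: "code_at P pc (compile pc c)"
      "code_at P (pc + code_size c) (compile (pc + code_size c) d)"
    by (simp_all add: code_at_append length_compile)
  obtain r' m' where first: "reaches P t (pc, r, m) (pc + code_size c, r', m')" and "wp d u Q r' m'"
    using assms code(1) by (rule wpE)
  from this(2) code(2) obtain r'' m'' where
    second: "reaches P u (pc + code_size c, r', m') (pc + code_size c + code_size d, r'', m'')"
    and "Q r'' m''"
    by (rule wpE)
  then show "\<exists>r' m'. reaches P (t + u) (pc, r, m) (pc + code_size (c ;; d), r', m') \<and> Q r' m'"
    using reaches_trans[OF first second] by (auto simp: add.assoc)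
qed

lemma wp_if_zero:
  assumes "r x = 0" and "wp d t Q r m"
  shows "wp (If_Nonzero x c d) (t + 1) Q r m"
proof (rule wpI)
  fix P pc
  let ?else = "pc + code_size c + 2"
  assume "code_at P pc (compile pc (If_Nonzero x c d))"
  then have test: "pc < length P" "P ! pc = Jump_Zero x ?else"
    and code: "code_at P ?else (compile ?else d)"
    by (simp_all add: code_at_Cons code_at_append length_compile add_ac)
  obtain r' m' where run: "reaches P t (?else, r, m) (?else + code_size d, r', m')" and "Q r' m'"
    using assms(2) code by (rule wpE)
  have "reaches P 1 (pc, r, m) (?else, r, m)"
    using reaches_Jump_Zero[OF test, of r m] assms(1) by simp
  from reaches_trans[OF this run] \<open>Q r' m'\<close> show "\<exists>r' m'. reaches P (t + 1) (pc, r, m)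
      (pc + code_size (If_Nonzero x c d), r', m') \<and> Q r' m'"
    by (auto simp: add_ac)
qed

lemma wp_if_nonzero:
  assumes "r x \<noteq> 0" and "wp c t Q r m"
  shows "wp (If_Nonzero x c d) (t + 2) Q r m"
proof (rule wpI)
  fix P pc
  let ?else = "pc + code_size c + 2"
  assume "code_at P pc (compile pc (If_Nonzero x c d))"
  then have test: "pc < length P" "P ! pc = Jump_Zero x ?else"
    and code: "code_at P (pc + 1) (compile (pc + 1) c)"
    and skip: "pc + 1 + code_size c < length P"
      "P ! (pc + 1 + code_size c) = Jump (?else + code_size d)"
    by (simp_all add: code_at_Cons code_at_append length_compile add_ac)
  obtain r' m' where
    run: "reaches P t (pc + 1, r, m) (pc + 1 + code_size c, r', m')" and "Q r' m'"
    using assms(2) code by (rule wpE)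
  have "reaches P 1 (pc, r, m) (pc + 1, r, m)"
    using reaches_Jump_Zero[OF test, of r m] assms(1) by simp
  from reaches_trans[OF this reaches_trans[OF run reaches_Jump[OF skip]]] \<open>Q r' m'\<close>
  show "\<exists>r' m'. reaches P (t + 2) (pc, r, m)
      (pc + code_size (If_Nonzero x c d), r', m') \<and> Q r' m'"
    by (auto simp: add_ac)
qed

lemma wp_if:
  assumes "wp (if r x = 0 then d else c) t Q r m"
  shows "wp (If_Nonzero x c d) (t + 2) Q r m"
  using assms wp_if_nonzero wp_mono_time[OF wp_if_zero] by (cases "r x = 0") simp_all

lemma wp_while_zero:
  assumes "r x = 0" and "Q r m"
  shows "wp (While_Nonzero x c) 1 Q r m"
proof (rule wpI)
  fix P pc
  assume "code_at P pc (compile pc (While_Nonzero x c))"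
  then have test: "pc < length P" "P ! pc = Jump_Zero x (pc + code_size c + 2)"
    by (simp_all add: code_at_Cons)
  show "\<exists>r' m'. reaches P 1 (pc, r, m) (pc + code_size (While_Nonzero x c), r', m') \<and> Q r' m'"
    using reaches_Jump_Zero[OF test, of r m] assms by (auto simp: add.assoc)
qed

lemma wp_while_nonzero:
  assumes "r x \<noteq> 0" and "wp c t (wp (While_Nonzero x c) u Q) r m"
  shows "wp (While_Nonzero x c) (t + 2 + u) Q r m"
proof (rule wpI)
  fix P pc
  assume loop: "code_at P pc (compile pc (While_Nonzero x c))"
  then have test: "pc < length P" "P ! pc = Jump_Zero x (pc + code_size c + 2)"
    and code: "code_at P (pc + 1) (compile (pc + 1) c)"
    and jump_back: "pc + 1 + code_size c < length P" "P ! (pc + 1 + code_size c) = Jump pc"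
    by (simp_all add: code_at_Cons code_at_append length_compile)
  obtain r1 m1 where body: "reaches P t (pc + 1, r, m) (pc + 1 + code_size c, r1, m1)"
    and "wp (While_Nonzero x c) u Q r1 m1"
    using assms(2) code by (rule wpE)
  from this(2) loop obtain r' m' where
    rest: "reaches P u (pc, r1, m1) (pc + code_size (While_Nonzero x c), r', m')" and "Q r' m'"
    by (rule wpE)
  have "reaches P 1 (pc, r, m) (pc + 1, r, m)"
    using reaches_Jump_Zero[OF test, of r m] assms(1) by simp
  then have "reaches P (1 + (t + (1 + u))) (pc, r, m)
      (pc + code_size (While_Nonzero x c), r', m')"
    using body reaches_Jump[OF jump_back] rest by (blast intro: reaches_trans)
  then have "reaches P (t + 2 + u) (pc, r, m) (pc + code_size (While_Nonzero x c), r', m')"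
    by (rule reaches_mono) simp
  then show "\<exists>r' m'. reaches P (t + 2 + u) (pc, r, m)
      (pc + code_size (While_Nonzero x c), r', m') \<and> Q r' m'"
    using \<open>Q r' m'\<close> by blast
qed

lemma wp_while:
  assumes "I i r m"
    and body: "\<And>i r m. I (Suc i) r m \<Longrightarrow> r x \<noteq> 0 \<and> wp c t (I i) r m"
    and finish: "\<And>r m. I 0 r m \<Longrightarrow> r x = 0 \<and> Q r m"
  shows "wp (While_Nonzero x c) (i * (t + 2) + 1) Q r m"
  using assms(1)
proof (induction i arbitrary: r m)
  case 0
  then show ?case using finish wp_while_zero by simp
next
  case (Suc i)
  then have "r x \<noteq> 0" and "wp c t (I i) r m" using body by blast+
  then have "wp c t (wp (While_Nonzero x c) (i * (t + 2) + 1) Q) r m"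
    using Suc.IH by (blast intro: wp_mono_post)
  with \<open>r x \<noteq> 0\<close> have "wp (While_Nonzero x c) (t + 2 + (i * (t + 2) + 1)) Q r m"
    by (rule wp_while_nonzero)
  then show ?case by (simp add: add_ac)
qed

lemma wp_computes_within:
  assumes "wp c t (\<lambda>r m. r 0 = y) ((\<lambda>_. 0)(0 := length xs))
    (\<lambda>a. if a < length xs then xs ! a else 0)"
  shows "computes_within (compile 0 c) xs t y"
proof -
  have "code_at (compile 0 c) 0 (compile 0 c)" by (simp add: code_at_def)
  with assms obtain r m where
    "reaches (compile 0 c) t (init_config xs) (code_size c, r, m)" and "r 0 = y"
    unfolding init_config_def by (auto elim: wpE)
  then show ?thesis
    by (auto simp: halted_def length_compile intro: computes_withinI)
qed


section \<open>Powers and division\<close>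

abbreviation (input) "TMP \<equiv> 2 :: nat"

abbreviation (input) incr :: "nat \<Rightarrow> instr list" where
  "incr x \<equiv> [Const TMP 1, Add x x TMP]"

abbreviation (input) decr :: "nat \<Rightarrow> instr list" where
  "decr x \<equiv> [Const TMP 1, Sub x x TMP]"

abbreviation (input) copy :: "nat \<Rightarrow> nat \<Rightarrow> instr list" where
  "copy x y \<equiv> [Const x 0, Add x x y]"

definition power_com :: "nat \<Rightarrow> nat \<Rightarrow> nat \<Rightarrow> com" where
  "power_com b x e =
     Block [Const x 1] ;;
     While_Nonzero e (Block (Const TMP 0 # replicate b (Add TMP TMP x) @ copy x TMP @ decr e))"

lemma funpow_exec_basic_Add:
  "x \<noteq> y \<Longrightarrow> (exec_basic (Add x x y) ^^ b) (r, m) = (r(x := r x + b * r y), m)"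
  by (induction b) auto

lemma wp_power_com:
  assumes "distinct [x, e, TMP]"
    and post: "\<And>z. Q (r(x := b ^ r e, e := 0, TMP := z)) m"
  shows "wp (power_com b x e) (r e * (b + 7) + 2) Q r m"
proof -
  let ?body = "Block (Const TMP 0 # replicate b (Add TMP TMP x) @ copy x TMP @ decr e)"
  define loop_inv where "loop_inv i r' m' \<longleftrightarrow>
      i \<le> r e \<and> (\<exists>z. r' = r(x := b ^ (r e - i), e := i, TMP := z)) \<and> m' = m"
    for i and r' m' :: cells
  have "wp (While_Nonzero e ?body) (r e * ((b + 5) + 2) + 1) Q (r(x := 1)) m"
  proof (rule wp_while[where I = loop_inv])
    show "loop_inv (r e) (r(x := 1)) m"
      using assms(1) by (auto simp: loop_inv_def fun_eq_iff)
  next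
    fix i r' m'
    assume "loop_inv (Suc i) r' m'"
    then obtain z where i_le: "Suc i \<le> r e" and mem_eq: "m' = m"
      and regs_eq: "r' = r(x := b ^ (r e - Suc i), e := Suc i, TMP := z)"
      unfolding loop_inv_def by blast
    have "b * b ^ (r e - Suc i) = b ^ (r e - i)"
      using i_le by (simp flip: power_Suc add: Suc_diff_Suc)
    then have "wp ?body (b + 5) (loop_inv i) r' m'"
      using assms(1) i_le
      by (intro wp_block) (auto simp: loop_inv_def regs_eq mem_eq funpow_exec_basic_Add fun_eq_iff)
    then show "r' e \<noteq> 0 \<and> wp ?body (b + 5) (loop_inv i) r' m'"
      using assms(1) by (simp add: regs_eq)
  next
    fix r' m'
    assume "loop_inv 0 r' m'"
    then show "r' e = 0 \<and> Q r' m'" using assms by (auto simp: loop_inv_def)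
  qed
  then have "wp (power_com b x e) (1 + (r e * ((b + 5) + 2) + 1)) Q r m"
    unfolding power_com_def by (intro wp_seq wp_block) simp_all
  then show ?thesis by (rule wp_mono_time) simp
qed

lemma computable_power: "computable (\<lambda>k. b ^ k)"
proof -
  let ?c = "Block [Const TMP 0, Load 3 TMP] ;; power_com b 0 3"
  have "wp ?c (2 + (k * (b + 7) + 2)) (\<lambda>r m. r 0 = b ^ k)
      ((\<lambda>_. 0)(0 := length [k])) (\<lambda>a. if a < length [k] then [k] ! a else 0)" for k
    by (rule wp_mono_time, (rule wp_seq wp_block wp_power_com | simp)+)
  then have "computes_within (compile 0 ?c) [k] (2 + (k * (b + 7) + 2)) (b ^ k)" for k
    by (rule wp_computes_within)
  then show ?thesis unfolding computable_def by blast
qed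

definition divmod_com :: "nat \<Rightarrow> nat \<Rightarrow> nat \<Rightarrow> nat \<Rightarrow> com" where
  "divmod_com d x q t =
     Block [Const q 0, Const TMP (d - 1), Sub t x TMP] ;;
     While_Nonzero t
       (Block ([Const TMP d, Sub x x TMP] @ incr q @ [Const TMP (d - 1), Sub t x TMP]))"

lemma wp_divmod_com:
  assumes "0 < d" and distinct: "distinct [x, q, t, TMP]"
    and post: "Q (r(x := r x mod d, q := r x div d, t := 0, TMP := d - 1)) m"
  shows "wp (divmod_com d x q t) (8 * (r x div d) + 4) Q r m"
proof -
  let ?body = "Block ([Const TMP d, Sub x x TMP] @ incr q @ [Const TMP (d - 1), Sub t x TMP])"
  define loop_inv where "loop_inv i r' m' \<longleftrightarrow> i \<le> r x div d \<and> m' = m \<and>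
      r' = r(x := i * d + r x mod d, q := r x div d - i,
        t := i * d + r x mod d - (d - 1), TMP := d - 1)"
    for i and r' m' :: cells
  have "wp (While_Nonzero t ?body) (r x div d * (6 + 2) + 1) Q
      (r(q := 0, TMP := d - 1, t := r x - (d - 1))) m"
  proof (rule wp_while[where I = loop_inv])
    show "loop_inv (r x div d) (r(q := 0, TMP := d - 1, t := r x - (d - 1))) m"
      using distinct by (auto simp: loop_inv_def fun_eq_iff)
  next
    fix i r' m'
    assume inv: "loop_inv (Suc i) r' m'"
    then have "wp ?body 6 (loop_inv i) r' m'"
      using distinct by (intro wp_block) (auto simp: loop_inv_def fun_eq_iff)
    moreover have "r' t \<noteq> 0"
      using inv \<open>0 < d\<close> distinct by (auto simp: loop_inv_def)
    ultimately show "r' t \<noteq> 0 \<and> wp ?body 6 (loop_inv i) r' m'" by simp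
  next
    fix r' m'
    assume "loop_inv 0 r' m'"
    then show "r' t = 0 \<and> Q r' m'"
      using assms mod_less_divisor[OF \<open>0 < d\<close>, of "r x"] by (auto simp: loop_inv_def)
  qed
  then have "wp (divmod_com d x q t) (3 + (r x div d * (6 + 2) + 1)) Q r m"
    unfolding divmod_com_def using distinct by (intro wp_seq wp_block) simp_all
  then show ?thesis by (rule wp_mono_time) simp
qed


section \<open>Branching\<close>

text \<open>The base-3 digits of \<open>s\<close> are the branching decisions: an edge that the vertices in \<open>M\<close> do
  not cover is paid for itself (digit 0), or by its first (1) or second (2) end.\<close>

fun branching_weight :: "nat \<Rightarrow> 'a set \<Rightarrow> ('a \<times> 'a) list \<Rightarrow> nat" where
  "branching_weight s M [] = 0"
| "branching_weight s M ((u, v) # es) =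
     (if u \<in> M \<or> v \<in> M then branching_weight s M es
      else if s mod 3 = 0 then 1 + branching_weight (s div 3) M es
      else 2 + branching_weight (s div 3) (insert (if s mod 3 = 1 then u else v) M) es)"

abbreviation uncovered :: "'a set \<Rightarrow> ('a \<times> 'a) list \<Rightarrow> ('a \<times> 'a) list" where
  "uncovered M \<equiv> filter (\<lambda>(u, v). u \<notin> M \<and> v \<notin> M)"

definition completion_weight :: "'a set \<Rightarrow> 'a set \<Rightarrow> ('a \<times> 'a) list \<Rightarrow> nat" where
  "completion_weight M R es = length (uncovered (M \<union> R) es) + 2 * card R"

lemma completion_weight_insert:
  assumes "finite R" and "w \<notin> R"
  shows "completion_weight M (insert w R) es = 2 + completion_weight (insert w M) R es"
  using assms by (simp add: completion_weight_def)

lemma completion_weight_Cons: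
  "completion_weight M R ((u, v) # es) =
     (if u \<in> M \<union> R \<or> v \<in> M \<union> R then 0 else 1) + completion_weight M R es"
  by (simp add: completion_weight_def)

lemma branching_weight_sound:
  assumes "finite A" and "set es \<subseteq> A \<times> A"
  shows "\<exists>R\<subseteq>A. completion_weight M R es \<le> branching_weight s M es"
  using assms(2)
proof (induction s M es rule: branching_weight.induct)
  case (1 s M)
  show ?case by (intro exI[of _ "{}"]) (simp add: completion_weight_def)
next
  case (2 s M u v es)
  consider (covered) "u \<in> M \<or> v \<in> M" | (edge) "u \<notin> M" "v \<notin> M" "s mod 3 = 0"
    | (vertex) "u \<notin> M" "v \<notin> M" "s mod 3 \<noteq> 0"
    by blast
  then show ?case
  proof cases
    case covered
    then show ?thesis using "2.IH"(1) "2.prems" by (auto simp: completion_weight_Cons)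
  next
    case edge
    then obtain R where "R \<subseteq> A" "completion_weight M R es \<le> branching_weight (s div 3) M es"
      using "2.IH"(2) "2.prems" by auto
    then show ?thesis using edge by (intro exI[of _ R]) (auto simp: completion_weight_Cons)
  next
    case vertex
    define w where "w = (if s mod 3 = 1 then u else v)"
    obtain R where "R \<subseteq> A"
      and weight: "completion_weight (insert w M) R es \<le> branching_weight (s div 3) (insert w M) es"
      using "2.IH"(3) "2.prems" vertex unfolding w_def by auto
    have "completion_weight M (insert w R) ((u, v) # es) \<le> 2 + completion_weight (insert w M) R es"
      using finite_subset[OF \<open>R \<subseteq> A\<close> \<open>finite A\<close>]
      by (auto simp: completion_weight_def card_insert_if w_def)
    moreover have "insert w R \<subseteq> A" using \<open>R \<subseteq> A\<close> "2.prems" by (auto simp: w_def)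
    moreover have
      "branching_weight s M ((u, v) # es) = 2 + branching_weight (s div 3) (insert w M) es"
      using vertex by (simp add: w_def)
    ultimately show ?thesis using weight by (intro exI[of _ "insert w R"]) linarith
  qed
qed

lemma branching_weight_complete:
  assumes "finite R" and "completion_weight M R es \<le> k"
  shows "\<exists>s<3 ^ k. branching_weight s M es \<le> k"
  using assms
proof (induction es arbitrary: k M R)
  case Nil
  show ?case by (intro exI[of _ 0]) simp
next
  case (Cons e es)
  obtain u v where e_eq: "e = (u, v)" by (cases e)
  consider (covered) "u \<in> M \<or> v \<in> M" | (edge) "u \<notin> M \<union> R" "v \<notin> M \<union> R"
    | (vertex) w and d :: nat where "u \<notin> M" "v \<notin> M" "w \<in> R" "(d, w) \<in> {(1, u), (2, v)}"
    by blast
  then show ?case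
  proof cases
    case covered
    then show ?thesis
      using Cons.IH[of R M k] Cons.prems by (auto simp: e_eq completion_weight_Cons)
  next
    case edge
    then obtain l where k_eq: "k = Suc l" and "completion_weight M R es \<le> l"
      using Cons.prems(2) by (cases k) (auto simp: e_eq completion_weight_Cons)
    then obtain s where "s < 3 ^ l" "branching_weight s M es \<le> l"
      using Cons.IH Cons.prems(1) by blast
    then have "3 * s < 3 ^ k" "branching_weight (3 * s) M (e # es) \<le> k"
      using edge by (simp_all add: e_eq k_eq)
    then show ?thesis by blast
  next
    case vertex
    have "completion_weight M R es = 2 + completion_weight (insert w M) (R - {w}) es"
      using completion_weight_insert[of "R - {w}" w] vertex(3) Cons.prems(1)
      by (simp add: insert_absorb)
    then have weight: "2 + completion_weight (insert w M) (R - {w}) es \<le> k"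
      using Cons.prems(2) by (simp add: e_eq completion_weight_Cons)
    then obtain l where k_eq: "k = 2 + l"
      using add_leD1 le_Suc_ex by blast
    then obtain s where "s < 3 ^ l" "branching_weight s (insert w M) es \<le> l"
      using Cons.IH[of "R - {w}" "insert w M" l] Cons.prems(1) weight
      unfolding k_eq nat_add_left_cancel_le by blast
    then have "d + 3 * s < 3 ^ k" "branching_weight (d + 3 * s) M (e # es) \<le> k"
      using vertex by (auto simp: e_eq k_eq)
    then show ?thesis by blast
  qed
qed

corollary ex_branching_weight_le_iff:
  assumes "finite A" and "set es \<subseteq> A \<times> A"
  shows "(\<exists>s<3 ^ k. branching_weight s {} es \<le> k) \<longleftrightarrow>
    (\<exists>R\<subseteq>A. completion_weight {} R es \<le> k)"
proof
  assume "\<exists>s<3 ^ k. branching_weight s {} es \<le> k"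
  then obtain s where "branching_weight s {} es \<le> k" by blast
  moreover obtain R where "R \<subseteq> A" "completion_weight {} R es \<le> branching_weight s {} es"
    using branching_weight_sound[OF assms] by blast
  ultimately show "\<exists>R\<subseteq>A. completion_weight {} R es \<le> k"
    by (intro exI[of _ R]) simp
next
  assume "\<exists>R\<subseteq>A. completion_weight {} R es \<le> k"
  then obtain R where "finite R" "completion_weight {} R es \<le> k"
    using finite_subset[OF _ assms(1)] by auto
  then show "\<exists>s<3 ^ k. branching_weight s {} es \<le> k"
    by (rule branching_weight_complete)
qed

lemma ex_roman_vertex_cover_iff:
  assumes "finite E"
  shows "(\<exists>R1. roman_vertex_cover V E R1 R2 \<and> rvc_weight R1 R2 \<le> k) \<longleftrightarrow>
    R2 \<subseteq> V \<and> card {e \<in> E. e \<inter> R2 = {}} + 2 * card R2 \<le> k"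
proof
  assume "\<exists>R1. roman_vertex_cover V E R1 R2 \<and> rvc_weight R1 R2 \<le> k"
  then obtain R1 where uncovered_subset: "R1 \<subseteq> E" "{e \<in> E. e \<inter> R2 = {}} \<subseteq> R1"
    and "R2 \<subseteq> V" "card R1 + 2 * card R2 \<le> k"
    unfolding roman_vertex_cover_def rvc_weight_def by blast
  moreover have "card {e \<in> E. e \<inter> R2 = {}} \<le> card R1"
    using uncovered_subset assms by (meson card_mono finite_subset)
  ultimately show "R2 \<subseteq> V \<and> card {e \<in> E. e \<inter> R2 = {}} + 2 * card R2 \<le> k" by simp
next
  assume "R2 \<subseteq> V \<and> card {e \<in> E. e \<inter> R2 = {}} + 2 * card R2 \<le> k"
  then show "\<exists>R1. roman_vertex_cover V E R1 R2 \<and> rvc_weight R1 R2 \<le> k"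
    by (intro exI[of _ "{e \<in> E. e \<inter> R2 = {}}"])
      (auto simp: roman_vertex_cover_def rvc_weight_def)
qed

lemma card_uncovered_edges:
  assumes "inj_on f A" and "set es \<subseteq> A \<times> A" and "R \<subseteq> A"
    and "distinct (map (\<lambda>(u, v). {f u, f v}) es)"
  shows "card {e \<in> set (map (\<lambda>(u, v). {f u, f v}) es). e \<inter> f ` R = {}} =
    length (uncovered R es)"
proof -
  define edge where "edge = (\<lambda>(u, v). {f u, f v})"
  have "edge p \<inter> f ` R = {} \<longleftrightarrow> (case p of (u, v) \<Rightarrow> u \<notin> R \<and> v \<notin> R)"
    if "p \<in> set es" for p
  proof (cases p)
    case (Pair u v)
    then have "u \<in> A" "v \<in> A" using that assms(2) by auto
    then show ?thesis
      using inj_on_image_mem_iff[OF assms(1) _ assms(3)] Pair by (simp add: edge_def)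
  qed
  then have uncovered: "{p \<in> set es. edge p \<inter> f ` R = {}} = set (uncovered R es)"
    by (simp cong: conj_cong)
  have "distinct (map edge (uncovered R es))"
    using assms(4) unfolding edge_def by (rule distinct_map_filter)
  then have "card (edge ` set (uncovered R es)) = length (uncovered R es)"
    by (simp only: distinct_card flip: set_map length_map[of edge])
  moreover have "{e \<in> set (map edge es). e \<inter> f ` R = {}} = edge ` set (uncovered R es)"
    unfolding uncovered[symmetric] by auto
  ultimately show ?thesis
    unfolding edge_def[symmetric] by (simp only:)
qed

lemma rvc_yes_iff_branching_weight:
  assumes graph: "graph V E" and vs: "distinct vs" "set vs = V"
    and ends: "\<forall>(i, j)\<in>set es. i < length vs \<and> j < length vs"
    and edges: "distinct (map (\<lambda>(i, j). {vs ! i, vs ! j}) es)"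
      "set (map (\<lambda>(i, j). {vs ! i, vs ! j}) es) = E"
  shows "(V, E, k) \<in> rvc_yes \<longleftrightarrow> (\<exists>s<3 ^ k. branching_weight s {} es \<le> k)"
proof -
  let ?A = "{..<length vs}"
  have inj: "inj_on ((!) vs) ?A" using vs(1) by (simp add: inj_on_nth)
  have V_eq: "V = (!) vs ` ?A" using vs(2) by (auto simp: set_conv_nth)
  have "finite E" using edges(2) by blast
  have es_subset: "set es \<subseteq> ?A \<times> ?A" using ends by auto
  have "(V, E, k) \<in> rvc_yes \<longleftrightarrow>
      (\<exists>R2. \<exists>R1. roman_vertex_cover V E R1 R2 \<and> rvc_weight R1 R2 \<le> k)"
    using graph by (auto simp: rvc_yes_def)
  also have "\<dots> \<longleftrightarrow> (\<exists>R2\<subseteq>V. card {e \<in> E. e \<inter> R2 = {}} + 2 * card R2 \<le> k)"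
    unfolding ex_roman_vertex_cover_iff[OF \<open>finite E\<close>] ..
  also have "\<dots> \<longleftrightarrow>
      (\<exists>R\<subseteq>?A. card {e \<in> E. e \<inter> (!) vs ` R = {}} + 2 * card ((!) vs ` R) \<le> k)"
    unfolding V_eq subset_image_iff by blast
  also have "\<dots> \<longleftrightarrow> (\<exists>R\<subseteq>?A. completion_weight {} R es \<le> k)"
    using card_uncovered_edges[OF inj es_subset _ edges(1)] card_image[OF inj_on_subset[OF inj]]
    unfolding edges(2) completion_weight_def sup_bot_left by (metis (lifting))
  also have "\<dots> \<longleftrightarrow> (\<exists>s<3 ^ k. branching_weight s {} es \<le> k)"
    using ex_branching_weight_le_iff[OF _ es_subset] by simp
  finally show ?thesis .
qed


section \<open>The machine program\<close>

text \<open>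
  Marks are kept above the input: vertex \<open>v\<close> is marked in the current round iff cell \<open>n + v\<close> holds
  the round number, where \<open>n\<close> is the length of the input. Earlier rounds leave smaller numbers, so
  the marks are never cleared, and subtracting the cell from the round number gives 0 only for
  the marked vertices.
\<close>

abbreviation (input) "LEN \<equiv> 0 :: nat"
abbreviation (input) "TEST \<equiv> 3 :: nat"
abbreviation (input) "BOUND \<equiv> 4 :: nat"
abbreviation (input) "GUESSES \<equiv> 5 :: nat"
abbreviation (input) "ROUND \<equiv> 6 :: nat"
abbreviation (input) "FOUND \<equiv> 7 :: nat"
abbreviation (input) "POS \<equiv> 8 :: nat"
abbreviation (input) "END1 \<equiv> 9 :: nat"
abbreviation (input) "END2 \<equiv> 10 :: nat"
abbreviation (input) "WEIGHT \<equiv> 11 :: nat"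
abbreviation (input) "GUESS \<equiv> 12 :: nat"
abbreviation (input) "QUOT \<equiv> 13 :: nat"

abbreviation (input) "PERSISTENT \<equiv> {LEN, BOUND, GUESSES, ROUND, FOUND}"

definition branch_com :: com where
  "branch_com =
     divmod_com 3 GUESS QUOT TEST ;;
     Block (incr WEIGHT) ;;
     If_Nonzero GUESS
       (Block (incr WEIGHT @ decr GUESS) ;;
        If_Nonzero GUESS (Block [Store END2 ROUND]) (Block [Store END1 ROUND]))
       (Block []) ;;
     Block (copy GUESS QUOT)"

definition edge_com :: com where
  "edge_com =
     Block ([Load END1 POS, Add END1 END1 LEN] @ incr POS @
       [Load END2 POS, Add END2 END2 LEN] @ incr POS @
       [Load TEST END1, Sub TEST ROUND TEST]) ;;
     If_Nonzero TEST
       (Block [Load TEST END2, Sub TEST ROUND TEST] ;; If_Nonzero TEST branch_com (Block []))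
       (Block []) ;;
     Block [Sub TEST LEN POS]"

definition verdict_com :: com where
  "verdict_com =
     Block [Sub TEST WEIGHT BOUND] ;;
     If_Nonzero TEST (Block []) (Block [Const FOUND 1]) ;;
     Block [Sub TEST GUESSES ROUND]"

definition round_com :: com where
  "round_com =
     Block (copy GUESS ROUND @ incr ROUND @ [Const WEIGHT 0, Const POS 3, Sub TEST LEN POS]) ;;
     While_Nonzero TEST edge_com ;;
     verdict_com"

definition rvc_com :: com where
  "rvc_com =
     Block ([Const TMP 0, Load BOUND TMP] @ copy TEST BOUND) ;;
     power_com 3 GUESSES TEST ;;
     Block [Const ROUND 0, Const FOUND 0, Sub TEST GUESSES ROUND] ;;
     While_Nonzero TEST round_com ;;
     Block (copy 0 FOUND)"

lemma wp_branch_com: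
  assumes post: "\<And>r' m'. \<lbrakk>\<forall>x. x \<notin> {TMP, TEST, WEIGHT, GUESS, QUOT} \<longrightarrow> r' x = r x;
      r' GUESS = r GUESS div 3; r' WEIGHT = r WEIGHT + (if r GUESS mod 3 = 0 then 1 else 2);
      m' = (if r GUESS mod 3 = 0 then m
        else m((if r GUESS mod 3 = 1 then r END1 else r END2) := r ROUND))\<rbrakk> \<Longrightarrow> Q r' m'"
  shows "wp branch_com (8 * (r GUESS div 3) + 25) Q r m"
proof -
  consider "r GUESS mod 3 = 0" | "r GUESS mod 3 = 1" | "r GUESS mod 3 = 2" by linarith
  then show ?thesis
    unfolding branch_com_def
    by (cases; rule wp_mono_time, (rule wp_seq wp_block wp_if wp_divmod_com post | simp)+)
qed

lemma wp_edge_com: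
  assumes ends: "m (r POS) = u" "m (Suc (r POS)) = v"
    and marks: "m (u + r LEN) \<le> r ROUND" "m (v + r LEN) \<le> r ROUND"
    and post_covered: "\<And>r'. \<lbrakk>m (u + r LEN) = r ROUND \<or> m (v + r LEN) = r ROUND;
      \<forall>x. x \<notin> {TMP, TEST, POS, END1, END2} \<longrightarrow> r' x = r x;
      r' POS = r POS + 2; r' TEST = r LEN - (r POS + 2)\<rbrakk> \<Longrightarrow> Q r' m"
    and post_uncovered: "\<And>r' m'. \<lbrakk>m (u + r LEN) < r ROUND; m (v + r LEN) < r ROUND;
      \<forall>x. x \<notin> {TMP, TEST, POS, END1, END2, WEIGHT, GUESS, QUOT} \<longrightarrow> r' x = r x;
      r' POS = r POS + 2; r' TEST = r LEN - (r POS + 2);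
      r' GUESS = r GUESS div 3; r' WEIGHT = r WEIGHT + (if r GUESS mod 3 = 0 then 1 else 2);
      m' = (if r GUESS mod 3 = 0 then m
        else m((if r GUESS mod 3 = 1 then u else v) + r LEN := r ROUND))\<rbrakk> \<Longrightarrow> Q r' m'"
  shows "wp edge_com (8 * (r GUESS div 3) + 45) Q r m"
proof -
  consider (covered)
      "m (u + r LEN) = r ROUND \<or> m (u + r LEN) < r ROUND \<and> m (v + r LEN) = r ROUND"
    | (uncovered) "m (u + r LEN) < r ROUND" "m (v + r LEN) < r ROUND"
    using marks by linarith
  then show ?thesis
  proof cases
    case covered
    then show ?thesis
      unfolding edge_com_def
      by - (elim disjE conjE; rule wp_mono_time,
          (rule wp_seq wp_block wp_if post_covered | simp add: ends)+)
  next
    case uncovered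
    then show ?thesis
      unfolding edge_com_def
      by - (rule wp_mono_time, (rule wp_seq wp_block wp_if wp_branch_com post_uncovered |
          simp add: ends split del: if_split | simp)+)
  qed
qed

definition marked :: "nat \<Rightarrow> nat \<Rightarrow> cells \<Rightarrow> nat set" where
  "marked n j m = {v. m (v + n) = j}"

lemma marked_upd: "marked n j (m(v + n := j)) = insert v (marked n j m)"
  by (auto simp: marked_def)

abbreviation flatten :: "('a \<times> 'a) list \<Rightarrow> 'a list" where
  "flatten es \<equiv> concat (map (\<lambda>(i, j). [i, j]) es)"

lemma length_flatten: "length (flatten es) = 2 * length es"
  by (induction es) auto

definition memory_inv :: "nat list \<Rightarrow> nat \<Rightarrow> cells \<Rightarrow> bool" where
  "memory_inv xs j m \<longleftrightarrow> (\<forall>a<length xs. m a = xs ! a) \<and> (\<forall>a\<ge>length xs. m a \<le> j)"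

lemma memory_inv_mono: "memory_inv xs j m \<Longrightarrow> j \<le> j' \<Longrightarrow> memory_inv xs j' m"
  by (fastforce simp: memory_inv_def)

lemma marked_empty:
  assumes "memory_inv xs j m" and "j < j'"
  shows "marked (length xs) j' m = {}"
proof -
  have "m (v + length xs) < j'" for v
    using assms le_less_trans unfolding memory_inv_def by (metis le_add2)
  then show ?thesis by (auto simp: marked_def dest: less_imp_neq)
qed

lemma memory_inv_mark: "memory_inv xs j m \<Longrightarrow> memory_inv xs j (m(v + length xs := j))"
  by (simp add: memory_inv_def)

definition scan_inv :: "nat list \<Rightarrow> cells \<Rightarrow> nat \<Rightarrow> nat \<Rightarrow> cells \<Rightarrow> cells \<Rightarrow> bool" where
  "scan_inv xs r0 w i r m \<longleftrightarrow>
     (\<forall>x\<in>PERSISTENT. r x = r0 x) \<and> r GUESS \<le> r0 GUESS \<and>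
     memory_inv xs (r0 ROUND) m \<and> r TEST = length xs - r POS \<and>
     (\<exists>es. length es = i \<and> drop (r POS) xs = flatten es \<and>
        r WEIGHT + branching_weight (r GUESS) (marked (length xs) (r0 ROUND) m) es = w)"

lemma scan_inv_SucE:
  assumes "scan_inv xs r0 w (Suc i) r m"
  obtains u v es where "length es = i" and "r TEST \<noteq> 0"
    and "m (r POS) = u" and "m (Suc (r POS)) = v" and "drop (r POS + 2) xs = flatten es"
    and "r WEIGHT + branching_weight (r GUESS) (marked (length xs) (r0 ROUND) m) ((u, v) # es) = w"
proof -
  obtain u v es where es: "length es = i" "drop (r POS) xs = u # v # flatten es"
    and weight:
      "r WEIGHT + branching_weight (r GUESS) (marked (length xs) (r0 ROUND) m) ((u, v) # es) = w"
    using assms by (auto simp: scan_inv_def length_Suc_conv)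
  have mem: "memory_inv xs (r0 ROUND) m" and test: "r TEST = length xs - r POS"
    using assms unfolding scan_inv_def by blast+
  have "length (drop (r POS) xs) = 2 + 2 * i"
    unfolding es(2) by (simp add: length_flatten es(1))
  then have length: "length xs = r POS + (2 + 2 * i)" by simp
  have tails: "drop (Suc (r POS)) xs = v # flatten es" "drop (r POS + 2) xs = flatten es"
    using es(2) by (simp_all add: drop_Suc flip: tl_drop)
  have "m (r POS) = u" "m (Suc (r POS)) = v"
    using mem length nth_via_drop[OF es(2)] nth_via_drop[OF tails(1)]
    by (simp_all add: memory_inv_def)
  then show thesis using that es(1) tails(2) weight length test by simp
qed

lemma wp_edge_com_scan_inv:
  assumes inv: "scan_inv xs r0 w (Suc i) r m" and len: "r0 LEN = length xs"
  shows "wp edge_com (3 * r0 GUESS + 45) (scan_inv xs r0 w i) r m"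
proof -
  obtain u v es where ends: "m (r POS) = u" "m (Suc (r POS)) = v"
    and es: "length es = i" "drop (r POS + 2) xs = flatten es"
    and weight:
      "r WEIGHT + branching_weight (r GUESS) (marked (length xs) (r0 ROUND) m) ((u, v) # es) = w"
    using inv by (rule scan_inv_SucE)
  have kept: "\<forall>x\<in>PERSISTENT. r x = r0 x" "r GUESS \<le> r0 GUESS"
    and mem: "memory_inv xs (r0 ROUND) m"
    using inv unfolding scan_inv_def by blast+
  have "wp edge_com (8 * (r GUESS div 3) + 45) (scan_inv xs r0 w i) r m"
  proof (rule wp_edge_com)
    show "m (r POS) = u" "m (Suc (r POS)) = v" by (fact ends)+
    show "m (u + r LEN) \<le> r ROUND" "m (v + r LEN) \<le> r ROUND"
      using mem kept(1) len by (simp_all add: memory_inv_def)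
  next
    fix r'
    assume "m (u + r LEN) = r ROUND \<or> m (v + r LEN) = r ROUND"
      "\<forall>x. x \<notin> {TMP, TEST, POS, END1, END2} \<longrightarrow> r' x = r x"
      "r' POS = r POS + 2" "r' TEST = r LEN - (r POS + 2)"
    then show "scan_inv xs r0 w i r' m"
      using kept mem es weight len by (auto simp: scan_inv_def marked_def)
  next
    fix r' m'
    assume "m (u + r LEN) < r ROUND" "m (v + r LEN) < r ROUND"
      and step: "\<forall>x. x \<notin> {TMP, TEST, POS, END1, END2, WEIGHT, GUESS, QUOT} \<longrightarrow> r' x = r x"
        "r' POS = r POS + 2" "r' TEST = r LEN - (r POS + 2)"
        "r' GUESS = r GUESS div 3" "r' WEIGHT = r WEIGHT + (if r GUESS mod 3 = 0 then 1 else 2)"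
        "m' = (if r GUESS mod 3 = 0 then m
          else m((if r GUESS mod 3 = 1 then u else v) + r LEN := r ROUND))"
    then have "u \<notin> marked (length xs) (r0 ROUND) m" "v \<notin> marked (length xs) (r0 ROUND) m"
      using kept(1) len by (simp_all add: marked_def)
    then show "scan_inv xs r0 w i r' m'"
      using step kept mem es weight len
      by (auto simp: scan_inv_def marked_upd memory_inv_mark)
  qed
  moreover have "8 * (r GUESS div 3) + 45 \<le> 3 * r0 GUESS + 45"
    using kept(2) by linarith
  ultimately show ?thesis by (rule wp_mono_time)
qed

lemma wp_scan:
  assumes len: "r LEN = length xs" and mem: "memory_inv xs j m" "j < r ROUND"
    and es: "drop (r POS) xs = flatten es" and init: "r WEIGHT = 0" "r TEST = r LEN - r POS"
    and post: "\<And>r' m'. \<lbrakk>\<forall>x\<in>PERSISTENT. r' x = r x;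
      memory_inv xs (r ROUND) m'; r' WEIGHT = branching_weight (r GUESS) {} es\<rbrakk> \<Longrightarrow> Q r' m'"
  shows "wp (While_Nonzero TEST edge_com) (length es * (3 * r GUESS + 45 + 2) + 1) Q r m"
proof (rule wp_while[where I = "scan_inv xs r (branching_weight (r GUESS) {} es)"])
  show "scan_inv xs r (branching_weight (r GUESS) {} es) (length es) r m"
    using len init es memory_inv_mono[OF mem(1)] mem(2) marked_empty[OF mem]
    by (auto simp: scan_inv_def)
next
  fix i r' m'
  assume "scan_inv xs r (branching_weight (r GUESS) {} es) (Suc i) r' m'"
  then show "r' TEST \<noteq> 0 \<and> wp edge_com (3 * r GUESS + 45)
      (scan_inv xs r (branching_weight (r GUESS) {} es) i) r' m'"
    using wp_edge_com_scan_inv len by (blast elim: scan_inv_SucE)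
next
  fix r' m'
  assume "scan_inv xs r (branching_weight (r GUESS) {} es) 0 r' m'"
  then show "r' TEST = 0 \<and> Q r' m'"
    by (intro conjI post) (auto simp: scan_inv_def)
qed

lemma wp_verdict_com:
  assumes post: "\<And>r'. \<lbrakk>\<forall>x. x \<notin> {TEST, FOUND} \<longrightarrow> r' x = r x; r' TEST = r GUESSES - r ROUND;
    r' FOUND = (if r WEIGHT \<le> r BOUND then 1 else r FOUND)\<rbrakk> \<Longrightarrow> Q r' m"
  shows "wp verdict_com 5 Q r m"
proof -
  consider "r WEIGHT \<le> r BOUND" | "r BOUND < r WEIGHT" by linarith
  then show ?thesis
    unfolding verdict_com_def
    by (cases; rule wp_mono_time, (rule wp_seq wp_block wp_if post | simp)+)
qed

definition round_inv ::
  "nat list \<Rightarrow> (nat \<times> nat) list \<Rightarrow> nat \<Rightarrow> nat \<Rightarrow> nat \<Rightarrow> cells \<Rightarrow> cells \<Rightarrow> bool" where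
  "round_inv xs es k N i r m \<longleftrightarrow>
     r LEN = length xs \<and> r BOUND = k \<and> r GUESSES = N \<and> r ROUND + i = N \<and> r TEST = i \<and>
     memory_inv xs (r ROUND) m \<and>
     r FOUND = (if \<exists>s<r ROUND. branching_weight s {} es \<le> k then 1 else 0)"

lemma wp_round_com:
  assumes xs: "drop 3 xs = flatten es" and inv: "round_inv xs es k N (Suc i) r m"
  shows "wp round_com (length es * (3 * N + 47) + 13) (round_inv xs es k N i) r m"
proof -
  define s where "s = r ROUND"
  define r1 where
    "r1 = r(GUESS := s, TMP := 1, ROUND := Suc s, WEIGHT := 0, POS := 3, TEST := length xs - 3)"
  have regs: "r LEN = length xs" "r BOUND = k" "r GUESSES = N" "r ROUND = s"
      "r FOUND = (if \<exists>s'<s. branching_weight s' {} es \<le> k then 1 else 0)"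
    and round: "Suc s + i = N" and mem: "memory_inv xs s m"
    using inv by (simp_all add: round_inv_def s_def)
  have verdict: "wp verdict_com 5 (round_inv xs es k N i) r2 m2"
    if "\<forall>x\<in>PERSISTENT. r2 x = r1 x"
      and "memory_inv xs (r1 ROUND) m2" "r2 WEIGHT = branching_weight (r1 GUESS) {} es" for r2 m2
    using that regs round by (intro wp_verdict_com) (auto simp: round_inv_def r1_def less_Suc_eq)
  have "wp (While_Nonzero TEST edge_com ;; verdict_com)
      (length es * (3 * r1 GUESS + 45 + 2) + 1 + 5) (round_inv xs es k N i) r1 m"
    using regs(1) xs by (intro wp_seq wp_scan[OF _ mem] verdict) (simp_all add: r1_def)
  then have "wp round_com (7 + (length es * (3 * r1 GUESS + 45 + 2) + 1 + 5))
      (round_inv xs es k N i) r m"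
    unfolding round_com_def by (intro wp_seq wp_block) (simp_all add: r1_def regs)
  moreover have "length es * (3 * r1 GUESS + 45 + 2) \<le> length es * (3 * N + 47)"
    using round by (intro mult_le_mono2) (simp add: r1_def)
  then have "7 + (length es * (3 * r1 GUESS + 45 + 2) + 1 + 5) \<le> length es * (3 * N + 47) + 13"
    by linarith
  ultimately show ?thesis by (rule wp_mono_time)
qed

lemma wp_rvc_com:
  assumes xs: "xs = k # l # length es # flatten es"
    and init: "r LEN = length xs" "memory_inv xs 0 m"
    and post: "\<And>r' m'. r' 0 = (if \<exists>s<3 ^ k. branching_weight s {} es \<le> k then 1 else 0) \<Longrightarrow>
      Q r' m'"
  shows "wp rvc_com (10 * k + 3 ^ k * (length es * (3 * 3 ^ k + 47) + 15) + 12) Q r m"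
proof -
  have drop: "drop 3 xs = flatten es" by (simp add: xs)
  have bound: "m 0 = k" using init(2) by (simp add: memory_inv_def xs)
  have rounds: "wp (While_Nonzero TEST round_com ;; Block (copy 0 FOUND))
      (3 ^ k * (length es * (3 * 3 ^ k + 47) + 13 + 2) + 1 + 2) Q r m"
    if "round_inv xs es k (3 ^ k) (3 ^ k) r m" for r
  proof (intro wp_seq wp_while[where I = "round_inv xs es k (3 ^ k)"])
    show "round_inv xs es k (3 ^ k) (3 ^ k) r m" by (fact that)
  next
    fix i r m
    assume "round_inv xs es k (3 ^ k) (Suc i) r m"
    then show "r TEST \<noteq> 0 \<and>
        wp round_com (length es * (3 * 3 ^ k + 47) + 13) (round_inv xs es k (3 ^ k) i) r m"
      by (intro conjI wp_round_com drop) (simp_all add: round_inv_def)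
  next
    fix r m
    assume "round_inv xs es k (3 ^ k) 0 r m"
    then show "r TEST = 0 \<and> wp (Block (copy 0 FOUND)) 2 Q r m"
      using post by (intro conjI wp_block) (auto simp: round_inv_def)
  qed
  show ?thesis
    unfolding rvc_com_def
    by (rule wp_mono_time, (rule rounds wp_seq wp_block wp_power_com |
        simp add: init bound round_inv_def)+)
qed

lemma rvc_time_le:
  fixes k l z :: nat
  assumes "l \<le> z"
  shows "10 * k + 3 ^ k * (l * (3 * 3 ^ k + 47) + 15) + 12 \<le> 9 ^ k * (37 + 50 * z)"
proof -
  define N :: nat where "N = 3 ^ k"
  have N_ge: "k \<le> N" "1 \<le> N" unfolding N_def by (simp_all add: less_imp_le)
  then have square: "N \<le> N * N" by simp
  have "9 ^ k = N * N" unfolding N_def by (simp flip: power_mult_distrib)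
  have "N * (l * (3 * N + 47)) \<le> N * (z * (3 * N + 47 * N))"
    using assms N_ge(2) by (intro mult_le_mono add_le_mono) auto
  also have "\<dots> = N * N * (50 * z)" by (simp add: algebra_simps)
  finally have "N * (l * (3 * N + 47)) \<le> N * N * (50 * z)" .
  moreover have "10 * k + N * 15 + 12 \<le> 37 * (N * N)" using N_ge square by linarith
  ultimately show ?thesis
    unfolding \<open>9 ^ k = N * N\<close> N_def[symmetric] by (simp add: algebra_simps)
qed

lemma computes_within_rvc_com:
  fixes es :: "(nat \<times> nat) list"
  assumes xs: "xs = k # l # length es # flatten es" and "length es \<le> z"
  shows "computes_within (compile 0 rvc_com) xs (9 ^ k * (37 + 50 * z))
    (if \<exists>s<3 ^ k. branching_weight s {} es \<le> k then 1 else 0)"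
proof (rule wp_computes_within[OF wp_mono_time[OF wp_rvc_com[OF xs] rvc_time_le]])
  show "memory_inv xs 0 (\<lambda>a. if a < length xs then xs ! a else 0)"
    by (simp add: memory_inv_def)
qed (simp_all add: assms(2))

theorem theorem24:
  shows "fixed_parameter_tractable rvc_instances rvc_encoding rvc_yes rvc_parameter rvc_size"
  unfolding fixed_parameter_tractable_def
proof (intro exI[of _ "compile 0 rvc_com"] exI[of _ "\<lambda>k. 9 ^ k"] exI[of _ "[:37, 50:]"] conjI
    computable_power ballI allI impI)
  fix i xs
  assume "i \<in> rvc_instances" and enc: "rvc_encoding i xs"
  obtain V E k where i_eq: "i = (V, E, k)" by (cases i)
  then have graph: "graph V E" using \<open>i \<in> rvc_instances\<close> by (simp add: rvc_instances_def)
  obtain vs es where vs: "distinct vs" "set vs = V"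
    and ends: "\<forall>(i, j)\<in>set es. i < length vs \<and> j < length vs"
    and edges: "distinct (map (\<lambda>(i, j). {vs ! i, vs ! j}) es)"
      "set (map (\<lambda>(i, j). {vs ! i, vs ! j}) es) = E"
    and xs: "xs = k # length vs # length es # flatten es"
    using enc unfolding i_eq rvc_encoding_def prod.case by blast
  have "length es \<le> rvc_size i"
    using distinct_card[OF edges(1)] edges(2) by (simp add: i_eq rvc_size_def)
  from computes_within_rvc_com[OF xs this]
  show "computes_within (compile 0 rvc_com) xs (9 ^ rvc_parameter i * poly [:37, 50:] (rvc_size i))
      (if i \<in> rvc_yes then 1 else 0)"
    unfolding i_eq rvc_yes_iff_branching_weight[OF graph vs ends edges]
    by (simp add: rvc_parameter_def mult.commute)
qed

end
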